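(* Fix an integer $K\ge1$ and $\sigma>0$. The mixture model over $\mathscr{M}$ is identifiable: if $(\{f_k\}_{k=1}^K,\{\lambda_k\}_{k=1}^K,\{\mu_k\}_{k=1}^K)$ and $(\{g_k\}_{k=1}^K,\{\pi_k\}_{k=1}^K,\{m_k\}_{k=1}^K)$ both belong to $\mathscr{M}$ and $$\sum_{k=1}^K\lambda_k f_k(y-\mu_k)=\sum_{k=1}^K\pi_k g_k(y-m_k)\qquad\text{for all }y\in\mathbb{R},$$ then there is a permutation $\Pi$ of $\{1,\dots,K\}$ such that $g_k=f_{\Pi(k)}$, $\pi_k=\lambda_{\Pi(k)}$ and $m_k=\mu_{\Pi(k)}$ for every $k$.
   Context: $\phi_\sigma$ is the density of $\mathcal{N}(0,\sigma^2)$; for a probability measure $G$ on $\mathbb{R}$, $(\phi_\sigma\ast G)(y)=\int\phi_\sigma(y-\theta)\,dG(\theta)$. $G(\cdot-\mu)$ denotes the translate of $G$ by $\mu$ (the law of $\theta+\mu$ with $\theta\sim G$). For nonempty $A,B\subset\mathbb{R}$, $\operatorname{dist}(A,B)=\inf_{x\in A,y\in B}|x-y|$. $\mathscr{M}$ is the set of tuples $(\{f_k\}_{k=1}^K,\{\lambda_k\}_{k=1}^K,\{\mu_k\}_{k=1}^K)$, with $f_k$ probability densities on $\mathbb{R}$ and $\lambda_k,\mu_k\in\mathbb{R}$, satisfying: (B1) $f_k=\phi_\sigma\ast G_k$ with $G_k$ a compactly supported probability measure on $\mathbb{R}$, and $\int_{\mathbb{R}}x f_k(x)\,dx=0$; (B2)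 $\min_k\lambda_k>0$ and $\sum_k\lambda_k=1$; (B3) $\min_{j\ne k}\operatorname{dist}\big(\operatorname{supp}(G_j(\cdot-\mu_j)),\operatorname{supp}(G_k(\cdot-\mu_k))\big)>\max_k\operatorname{diam}(\operatorname{supp}(G_k))$. The number $\sigma$ is fixed and the same for all members of the class. *)

theory Defs
  imports "HOL-Probability.Probability"
begin

definition gauss_conv :: "real \<Rightarrow> real measure \<Rightarrow> real \<Rightarrow> real" where
  "gauss_conv \<sigma> G y = (LINT \<theta>|G. normal_density 0 \<sigma> (y - \<theta>))"

definition prob_density_fun :: "(real \<Rightarrow> real) \<Rightarrow> bool" where
  "prob_density_fun f \<longleftrightarrow>
     f \<in> borel_measurable borel \<and> (\<forall>x. 0 \<le> f x) \<and> has_bochner_integral lborel f 1"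

definition msupp :: "real measure \<Rightarrow> real set" where
  "msupp M = {x. \<forall>U. open U \<and> x \<in> U \<longrightarrow> emeasure M U > 0}"

text \<open>The measure \<open>G(\<cdot> - \<mu>)\<close>, i.e. the law of \<open>\<theta> + \<mu>\<close> with \<open>\<theta> \<sim> G\<close>.\<close>

definition translate :: "real measure \<Rightarrow> real \<Rightarrow> real measure" where
  "translate G \<mu> = distr G borel (\<lambda>\<theta>. \<theta> + \<mu>)"

text \<open>Families indexed by \<open>k = 1, \<dots>, K\<close> are functions on \<^typ>\<open>nat\<close> of which only the values on
  \<open>{1..K}\<close> matter. The mixing measures \<open>G\<^sub>k\<close> are not components of the tuple, so they are
  existentially quantified. The mean-zero condition includes integrability, since the
  Bochner integral of a non-integrable function is \<open>0\<close> by convention.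
  In the separation condition the minimum over \<open>j \<noteq> k\<close> is unfolded into a quantifier, so for
  \<open>K = 1\<close> the condition is vacuous (minimum over the empty set is \<open>+\<infinity>\<close>).\<close>

definition mixture_class ::
  "nat \<Rightarrow> real \<Rightarrow> ((nat \<Rightarrow> real \<Rightarrow> real) \<times> (nat \<Rightarrow> real) \<times> (nat \<Rightarrow> real)) set" where
  "mixture_class K \<sigma> = {(f, w, \<mu>).
     (\<forall>k\<in>{1..K}. prob_density_fun (f k)) \<and>
     (\<exists>G :: nat \<Rightarrow> real measure.
        (\<forall>k\<in>{1..K}. real_distribution (G k) \<and> compact (msupp (G k)) \<and>
           f k = gauss_conv \<sigma> (G k) \<and>
           has_bochner_integral lborel (\<lambda>x. x * f k x) 0) \<and>
        (\<forall>k\<in>{1..K}. w k > 0) \<and> (\<Sum>k\<in>{1..K}. w k) = 1 \<and>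
        (\<forall>j\<in>{1..K}. \<forall>k\<in>{1..K}. j \<noteq> k \<longrightarrow>
           setdist (msupp (translate (G j) (\<mu> j))) (msupp (translate (G k) (\<mu> k)))
             > Max ((\<lambda>l. diameter (msupp (G l))) ` {1..K})))}"

end

theory Submission
  imports Defs
begin

text \<open>Both sides are Gaussian convolutions of a finite mixture of translated mixing measures. The
  Gaussian characteristic function has no zeros, so these two finite mixtures coincide. Let \<open>D\<close> be
  the maximal support diameter of one representation: two points of the common support lie in the
  same component of that representation iff their distance is at most \<open>D\<close>. Hence the partition for the smaller
  threshold refines the other one, and since both have \<open>K\<close> nonempty blocks they agree. Restricting
  the mixture to a block recovers the weight and the translated component, and the mean-zero
  normalisation fixes the translation.\<close>

section \<open>Characteristic functions and injectivity of Gaussian convolution\<close>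

lemma char_convolution:
  fixes M N :: "real measure"
  assumes "real_distribution M" "real_distribution N"
  shows "char (M \<star> N) t = char M t * char N t"
proof -
  interpret M: real_distribution M by fact
  interpret N: real_distribution N by fact
  interpret P: pair_prob_space M N ..
  have int: "integrable (M \<Otimes>\<^sub>M N) (\<lambda>(x, y). iexp (t * x) * iexp (t * y))"
    by (rule P.P.integrable_const_bound[where B=1])
      (auto simp: norm_mult)
  have "char (M \<star> N) t = (CLINT z|M \<Otimes>\<^sub>M N. iexp (t * (case z of (x, y) \<Rightarrow> x + y)))"
    unfolding char_def convolution_def by (subst integral_distr) auto
  also have "\<dots> = (CLINT z|M \<Otimes>\<^sub>M N. (case z of (x, y) \<Rightarrow> iexp (t * x) * iexp (t * y)))"
    by (rule Bochner_Integration.integral_cong)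
      (auto simp: exp_add[symmetric] algebra_simps)
  also have "\<dots> = (CLINT x|M. CLINT y|N. iexp (t * x) * iexp (t * y))"
    by (rule P.integral_fst[OF int, symmetric])
  also have "\<dots> = char M t * char N t"
    unfolding char_def by simp
  finally show ?thesis .
qed

text \<open>Scaling a standard normal variable by \<sigma> gives the value exp(-(t \<sigma>)^2 / 2),
  an exponential. This is what lets the Gaussian factor be cancelled later.\<close>

lemma char_normal_density_nonzero:
  assumes "\<sigma> > 0"
  shows "char (density lborel (normal_density 0 \<sigma>)) t \<noteq> 0"
proof -
  interpret S: real_distribution std_normal_distribution
    by (rule real_dist_normal_dist)
  have "distributed std_normal_distribution lborel (\<lambda>x. x) std_normal_density"
    by (auto simp: distributed_def intro!: measure_eqI simp: emeasure_distr)
  from S.normal_density_affine[OF this, of \<sigma> 0] assms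
  have "distributed std_normal_distribution lborel (\<lambda>x. \<sigma> * x) (normal_density 0 \<sigma>)"
    by simp
  from distributed_distr_eq_density[OF this]
  have "density lborel (normal_density 0 \<sigma>) = distr std_normal_distribution lborel (\<lambda>x. \<sigma> * x)"
    by simp
  then have "char (density lborel (normal_density 0 \<sigma>)) t = char std_normal_distribution (t * \<sigma>)"
    unfolding char_def by (simp add: integral_distr mult.assoc)
  then show ?thesis
    by (simp add: char_std_normal_distribution)
qed

lemma integrable_normal_density_shift:
  assumes "real_distribution M" "\<sigma> > 0"
  shows "integrable M (\<lambda>x. normal_density 0 \<sigma> (y - x))"
proof -
  interpret real_distribution M by fact
  show ?thesis
  proof (rule integrable_const_bound)
    show "AE x in M. norm (normal_density 0 \<sigma> (y - x)) \<le> 1 / sqrt (2 * pi * \<sigma>\<^sup>2)"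
      using assms by (auto simp: normal_density_def intro!: divide_right_mono)
  qed measurable
qed

text \<open>Exchanging the two integrals and substituting x + y for y links the pointwise formula
  \<open>gauss_conv\<close> to the convolution of measures, for which characteristic functions
  multiply.\<close>

lemma density_gauss_conv:
  assumes "real_distribution M" "\<sigma> > 0"
  shows "density lborel (gauss_conv \<sigma> M) = (M \<star> density lborel (normal_density 0 \<sigma>))"
    (is "?L = (M \<star> ?N)")
proof (rule measure_eqI)
  interpret M: real_distribution M by fact
  interpret N: prob_space ?N
    using assms(2) by (rule prob_space_normal_density)
  fix A :: "real set" assume "A \<in> sets ?L"
  then have [measurable]: "A \<in> sets borel" by simp
  interpret P: pair_sigma_finite M lborel ..
  \<comment> \<open>As an integral of a nonnegative function, the convolution can be handled by
    Tonelli, without an integrability argument on the product.\<close>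
  have nn: "ennreal (gauss_conv \<sigma> M y) = (\<integral>\<^sup>+x. normal_density 0 \<sigma> (y - x) \<partial>M)" for y
    unfolding gauss_conv_def
    by (rule nn_integral_eq_integral[symmetric])
      (auto intro!: integrable_normal_density_shift assms)
  have m: "gauss_conv \<sigma> M \<in> borel_measurable borel"
    unfolding gauss_conv_def[abs_def] by measurable
  have "emeasure ?L A = (\<integral>\<^sup>+y. (\<integral>\<^sup>+x. ennreal (normal_density 0 \<sigma> (y - x)) * indicator A y \<partial>M) \<partial>lborel)"
    using m by (subst emeasure_density) (auto simp: nn nn_integral_multc)
  also have "\<dots> = (\<integral>\<^sup>+x. (\<integral>\<^sup>+y. ennreal (normal_density 0 \<sigma> (y - x)) * indicator A y \<partial>lborel) \<partial>M)"
    by (rule P.Fubini') measurable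
  also have "\<dots> = (\<integral>\<^sup>+x. (\<integral>\<^sup>+y. ennreal (normal_density 0 \<sigma> y) * indicator A (x + y) \<partial>lborel) \<partial>M)"
    by (rule nn_integral_cong)
      (simp add: nn_integral_real_affine[where c=1, of "\<lambda>y. ennreal (normal_density 0 \<sigma> (y - x)) * indicator A y" x for x])
  also have "\<dots> = (\<integral>\<^sup>+x. (\<integral>\<^sup>+y. indicator A (x + y) \<partial>?N) \<partial>M)"
    by (intro nn_integral_cong, subst nn_integral_density) auto
  also have "\<dots> = emeasure (M \<star> ?N) A"
    by (rule convolution_emeasure'[symmetric])
      (auto intro: M.finite_measure_axioms N.finite_measure_axioms)
  finally show "emeasure ?L A = emeasure (M \<star> ?N) A" .
qed simp

text \<open>Equal densities give equal convolutions, whose characteristic functions factor. Dividing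
  by the nonvanishing Gaussian factor leaves equal characteristic functions, and Levy's theorem
  finishes.\<close>

lemma gauss_conv_inject:
  assumes "real_distribution M" "real_distribution M'" "\<sigma> > 0"
    and "gauss_conv \<sigma> M = gauss_conv \<sigma> M'"
  shows "M = M'"
proof (rule Levy_uniqueness)
  let ?N = "density lborel (normal_density 0 \<sigma>)"
  have N: "real_distribution ?N"
    using prob_space_normal_density[OF assms(3)]
    by (simp add: real_distribution_def real_distribution_axioms_def)
  have "(M \<star> ?N) = (M' \<star> ?N)"
    using assms by (simp flip: density_gauss_conv)
  then have "char M t * char ?N t = char M' t * char ?N t" for t
    using assms(1,2) N by (simp flip: char_convolution)
  then show "char M = char M'"
    using char_normal_density_nonzero[OF assms(3)] by auto
qed fact+

section \<open>Finite mixtures of probability measures\<close>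

lemma finite_mixture_measure:
  fixes N :: "'a \<Rightarrow> real measure" and w :: "'a \<Rightarrow> real"
  assumes I: "finite I" and w: "\<And>k. k \<in> I \<Longrightarrow> 0 \<le> w k" "(\<Sum>k\<in>I. w k) = 1"
    and N: "\<And>k. k \<in> I \<Longrightarrow> real_distribution (N k)"
  shows "\<exists>M. real_distribution M \<and>
    (\<forall>h B. h \<in> borel_measurable borel \<longrightarrow> (\<forall>x. \<bar>h x\<bar> \<le> B) \<longrightarrow>
      (LINT x|M. h x) = (\<Sum>k\<in>I. w k * (LINT x|N k. h x)))"
proof -
  \<comment> \<open>The mixture is built by drawing an index from a pmf and then a point from the
    chosen component. Both stages live on the whole index type, so the weights are extended by 0 and
    the components by a point mass at 0.\<close>
  define v where "v k = (if k \<in> I then w k else 0)" for k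
  define P where "P = embed_pmf v"
  define N' where "N' k = (if k \<in> I then N k else return borel 0)" for k
  have N': "real_distribution (N' k)" for k
    using N by (auto simp: N'_def real_distribution_def real_distribution_axioms_def prob_space_return)
  then have N'_prob: "prob_space (N' k)" and N'_sets: "sets (N' k) = sets borel" for k
    by (auto simp: real_distribution_def real_distribution_axioms_def)
  have "(\<integral>\<^sup>+k. v k \<partial>count_space UNIV) = (\<integral>\<^sup>+k. w k \<partial>count_space I)"
    by (subst nn_integral_count_space_indicator[of I])
      (auto simp: v_def intro!: nn_integral_cong split: split_indicator)
  also have "\<dots> = 1"
    using w by (simp add: nn_integral_count_space_finite I sum_ennreal)
  finally have v: "(\<integral>\<^sup>+k. v k \<partial>count_space UNIV) = 1" .
  have v0: "0 \<le> v k" for k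
    using w by (simp add: v_def)
  have pmf_P: "pmf P k = v k" for k
    unfolding P_def by (rule pmf_embed_pmf[OF v0 v])
  have set_P: "set_pmf P \<subseteq> I"
    unfolding P_def set_embed_pmf[OF v0 v] by (auto simp: v_def)
  have N'_meas: "N' \<in> measurable (measure_pmf P) (subprob_algebra borel)"
    using N'_prob N'_sets
    by (auto simp: measurable_def space_subprob_algebra prob_space_imp_subprob_space)
  define M where "M = measure_pmf P \<bind> N'"
  show ?thesis
  proof (intro exI[of _ M] conjI allI impI)
    have "prob_space M"
      unfolding M_def by (rule measure_pmf.prob_space_bind[OF _ N'_meas]) (simp add: N'_prob)
    moreover have "sets M = sets borel"
      unfolding M_def by (rule sets_bind) (auto simp: N'_sets)
    ultimately show "real_distribution M"
      by (simp add: real_distribution_def real_distribution_axioms_def)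
  next
    fix h :: "real \<Rightarrow> real" and B
    assume h: "h \<in> borel_measurable borel" "\<forall>x. \<bar>h x\<bar> \<le> B"
    have "(LINT x|M. h x) = (LINT k|measure_pmf P. LINT x|N' k. h x)"
      unfolding M_def
      by (rule integral_bind[where B=B and K=borel and B'=1])
        (use h N'_prob N'_meas in \<open>auto simp: prob_space.emeasure_space_1 measure_pmf.finite_measure\<close>)
    also have "\<dots> = (\<Sum>k\<in>I. pmf P k *\<^sub>R (LINT x|N' k. h x))"
      using set_P by (intro integral_measure_pmf I) auto
    also have "\<dots> = (\<Sum>k\<in>I. w k * (LINT x|N k. h x))"
      by (intro sum.cong) (auto simp: pmf_P v_def N'_def)
    finally show "(LINT x|M. h x) = (\<Sum>k\<in>I. w k * (LINT x|N k. h x))" .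
  qed
qed

text \<open>Each side is realised by a single measure, \<open>P\<close> or \<open>Q\<close>. Testing
  against the Gaussian kernel, a bounded function, gives equal convolutions and hence
  \<open>P = Q\<close>; testing against the indicator of \<open>A\<close> then returns to the
  weighted sums.\<close>

lemma measure_mixture_eq:
  fixes M N :: "'i \<Rightarrow> real measure" and w v :: "'i \<Rightarrow> real"
  assumes "\<sigma> > 0" "finite I"
    and "\<And>k. k \<in> I \<Longrightarrow> 0 \<le> w k" "(\<Sum>k\<in>I. w k) = 1" "\<And>k. k \<in> I \<Longrightarrow> real_distribution (M k)"
    and "\<And>k. k \<in> I \<Longrightarrow> 0 \<le> v k" "(\<Sum>k\<in>I. v k) = 1" "\<And>k. k \<in> I \<Longrightarrow> real_distribution (N k)"
    and eq: "\<And>y. (\<Sum>k\<in>I. w k * gauss_conv \<sigma> (M k) y) = (\<Sum>k\<in>I. v k * gauss_conv \<sigma> (N k) y)"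
    and A: "A \<in> sets borel"
  shows "(\<Sum>k\<in>I. w k * measure (M k) A) = (\<Sum>k\<in>I. v k * measure (N k) A)"
proof -
  have "\<exists>P. real_distribution P \<and>
    (\<forall>h B. h \<in> borel_measurable borel \<longrightarrow> (\<forall>x. \<bar>h x\<bar> \<le> B) \<longrightarrow>
      (LINT x|P. h x) = (\<Sum>k\<in>I. w k * (LINT x|M k. h x)))"
    by (rule finite_mixture_measure) (fact assms)+
  then obtain P where P: "real_distribution P"
    and P_int: "\<And>h B. h \<in> borel_measurable borel \<Longrightarrow> (\<And>x. \<bar>h x\<bar> \<le> B) \<Longrightarrow>
           (LINT x|P. h x) = (\<Sum>k\<in>I. w k * (LINT x|M k. h x))"
    by blast
  have "\<exists>Q. real_distribution Q \<and>
    (\<forall>h B. h \<in> borel_measurable borel \<longrightarrow> (\<forall>x. \<bar>h x\<bar> \<le> B) \<longrightarrow>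
      (LINT x|Q. h x) = (\<Sum>k\<in>I. v k * (LINT x|N k. h x)))"
    by (rule finite_mixture_measure) (fact assms)+
  then obtain Q where Q: "real_distribution Q"
    and Q_int: "\<And>h B. h \<in> borel_measurable borel \<Longrightarrow> (\<And>x. \<bar>h x\<bar> \<le> B) \<Longrightarrow>
           (LINT x|Q. h x) = (\<Sum>k\<in>I. v k * (LINT x|N k. h x))"
    by blast
  \<comment> \<open>The bound is the peak value of the normal density, attained at 0.\<close>
  have bound: "\<bar>normal_density 0 \<sigma> x\<bar> \<le> 1 / sqrt (2 * pi * \<sigma>\<^sup>2)" for x
    using assms(1) by (auto simp: normal_density_def intro!: divide_right_mono)
  have "gauss_conv \<sigma> P = gauss_conv \<sigma> Q"
  proof
    fix y
    have m: "(\<lambda>x. normal_density 0 \<sigma> (y - x)) \<in> borel_measurable borel"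
      by measurable
    show "gauss_conv \<sigma> P y = gauss_conv \<sigma> Q y"
      using eq[of y] unfolding gauss_conv_def P_int[OF m bound] Q_int[OF m bound] .
  qed
  then have "P = Q"
    using P Q assms(1) gauss_conv_inject by blast
  then have "(LINT x|P. indicator A x :: real) = (LINT x|Q. indicator A x)"
    by simp
  moreover have "(LINT x|P. indicator A x :: real) = (\<Sum>k\<in>I. w k * (LINT x|M k. indicator A x))"
    using A by (intro P_int[where B=1]) (auto split: split_indicator)
  moreover have "(LINT x|Q. indicator A x :: real) = (\<Sum>k\<in>I. v k * (LINT x|N k. indicator A x))"
    using A by (intro Q_int[where B=1]) (auto split: split_indicator)
  moreover have "(LINT x|M k. indicator A x :: real) = measure (M k) A"
    "(LINT x|N k. indicator A x :: real) = measure (N k) A" if "k \<in> I" for k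
    using assms(5,8)[OF that] by (simp_all add: real_distribution.space_eq_univ)
  ultimately show ?thesis
    by (simp cong: sum.cong)
qed

section \<open>Supports of measures on the line and their translates\<close>

lemma emeasure_compl_msupp:
  assumes "sets M = sets borel"
  shows "emeasure M (- msupp M) = 0"
proof -
  define \<F> where "\<F> = {U. open U \<and> emeasure M U = 0}"
  \<comment> \<open>The complement of the support is a possibly uncountable union of open null sets.
    Lindelof extracts a countable subfamily with the same union, which is therefore null.\<close>
  obtain \<F>' where \<F>': "\<F>' \<subseteq> \<F>" "countable \<F>'" "\<Union>\<F>' = \<Union>\<F>"
    using Lindelof[of \<F>] unfolding \<F>_def by blast
  have "(\<Union>U\<in>\<F>'. U) \<in> null_sets M"
    using \<F>' assms by (intro null_sets_UN') (auto simp: \<F>_def null_sets_def)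
  moreover have "- msupp M = \<Union>\<F>"
    unfolding msupp_def \<F>_def by (auto simp: not_gr_zero)
  ultimately show ?thesis
    using \<F>'(3) by auto
qed

lemma closed_msupp: "closed (msupp M)"
proof -
  have "- msupp M = \<Union>{U. open U \<and> emeasure M U = 0}"
    unfolding msupp_def by (auto simp: not_gr_zero)
  then show ?thesis
    by (metis (no_types, lifting) closed_def mem_Collect_eq open_Union)
qed

lemma measure_Int_msupp:
  assumes "real_distribution M" "A \<in> sets borel"
  shows "measure M (msupp M \<inter> A) = measure M A"
proof -
  interpret real_distribution M by fact
  have "- msupp M \<in> null_sets M"
    using emeasure_compl_msupp[OF events_eq_borel] closed_msupp[of M] by (auto simp: null_sets_def)
  then have "AE x in M. x \<in> msupp M"
    by (rule AE_I') auto
  then show ?thesis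
    using assms(2) closed_msupp[of M] by (intro measure_eq_AE) auto
qed

lemma msupp_nonempty:
  assumes "real_distribution M"
  shows "msupp M \<noteq> {}"
proof
  interpret real_distribution M by fact
  assume "msupp M = {}"
  then show False
    using measure_Int_msupp[OF assms, of UNIV] prob_space by simp
qed

lemma measure_zero_outside_msupp:
  assumes "real_distribution M" "A \<in> sets borel" "msupp M \<inter> A = {}"
  shows "measure M A = 0"
  using measure_Int_msupp[OF assms(1,2)] assms(3) by simp

lemma real_distribution_translate:
  assumes "real_distribution G"
  shows "real_distribution (translate G \<mu>)"
proof -
  interpret real_distribution G by fact
  show ?thesis
    unfolding translate_def by (rule real_distribution_distr) simp
qed

text \<open>Shifting a neighbourhood of x - \<mu> gives a neighbourhood of x with the same mass
  under the translate. This carries the diameter bound, which the class states for the untranslated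
  measures, over to the translates.\<close>

lemma msupp_translateD:
  assumes "real_distribution G" "x \<in> msupp (translate G \<mu>)"
  shows "x - \<mu> \<in> msupp G"
  unfolding msupp_def
proof (intro CollectI allI impI, elim conjE)
  interpret real_distribution G by fact
  fix U assume U: "open U" "x - \<mu> \<in> U"
  let ?V = "(\<lambda>y. y - \<mu>) -` U"
  have V: "open ?V"
    using U(1) by (intro open_vimage) (auto intro!: continuous_intros)
  with U(2) have "0 < emeasure (translate G \<mu>) ?V"
    using assms(2) by (auto simp: msupp_def)
  also have "emeasure (translate G \<mu>) ?V = emeasure G U"
    unfolding translate_def using V by (subst emeasure_distr) (auto simp: vimage_def)
  finally show "0 < emeasure G U" .
qed

lemma dist_msupp_translate_le:
  assumes "real_distribution G" "bounded (msupp G)"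
    and "x \<in> msupp (translate G \<mu>)" "y \<in> msupp (translate G \<mu>)"
  shows "dist x y \<le> diameter (msupp G)"
  using diameter_bounded_bound[OF assms(2) msupp_translateD[OF assms(1,3)]
    msupp_translateD[OF assms(1,4)]]
  by (simp add: dist_real_def)

lemma gauss_conv_translate:
  assumes "real_distribution G"
  shows "gauss_conv \<sigma> (translate G \<mu>) y = gauss_conv \<sigma> G (y - \<mu>)"
proof -
  interpret real_distribution G by fact
  show ?thesis
    unfolding gauss_conv_def translate_def
    by (subst integral_distr) (auto simp: algebra_simps)
qed

text \<open>With d = b - a, the function g is f moved by d. Since f has total integral 1 and first
  moment 0, g has first moment -d, and this must be 0.\<close>

lemma mean_zero_shift_unique:
  assumes f: "has_bochner_integral lborel f 1" "has_bochner_integral lborel (\<lambda>x. x * f x) 0"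
    and g: "has_bochner_integral lborel (\<lambda>x. x * g x) 0"
    and shift: "\<And>y. f (y - a) = g (y - b)"
  shows "a = (b :: real)" "f = g"
proof -
  let ?d = "b - a"
  have g_eq: "g y = f (y + ?d)" for y
    using shift[of "y + b"] by (simp add: algebra_simps)
  have "has_bochner_integral lborel (\<lambda>x. x * f x - ?d * f x) (0 - ?d * 1)"
    by (intro has_bochner_integral_diff has_bochner_integral_mult_right f)
  then have "has_bochner_integral lborel (\<lambda>x. (x - ?d) * f x) (- ?d)"
    by (simp add: algebra_simps)
  then have "has_bochner_integral lborel (\<lambda>x. x * g x) (- ?d)"
    by (subst (asm) lborel_has_bochner_integral_real_affine_iff[where c=1 and t="?d"])
      (auto simp: g_eq algebra_simps)
  with g show "a = b"
    using has_bochner_integral_eq by fastforce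
  then show "f = g"
    using g_eq by auto
qed

section \<open>Separated clusters and their matching\<close>

lemma mixture_classE:
  assumes "(f, w, \<mu>) \<in> mixture_class K \<sigma>"
  obtains M D where
    "\<And>k. k \<in> {1..K} \<Longrightarrow> real_distribution (M k)"
    "\<And>k y. k \<in> {1..K} \<Longrightarrow> f k (y - \<mu> k) = gauss_conv \<sigma> (M k) y"
    "\<And>k. k \<in> {1..K} \<Longrightarrow> has_bochner_integral lborel (f k) 1"
    "\<And>k. k \<in> {1..K} \<Longrightarrow> has_bochner_integral lborel (\<lambda>x. x * f k x) 0"
    "\<And>k. k \<in> {1..K} \<Longrightarrow> 0 < w k" "(\<Sum>k\<in>{1..K}. w k) = 1"
    "\<And>k x y. k \<in> {1..K} \<Longrightarrow> x \<in> msupp (M k) \<Longrightarrow> y \<in> msupp (M k) \<Longrightarrow> dist x y \<le> D"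
    "\<And>j k x y. j \<in> {1..K} \<Longrightarrow> k \<in> {1..K} \<Longrightarrow> j \<noteq> k \<Longrightarrow>
       x \<in> msupp (M j) \<Longrightarrow> y \<in> msupp (M k) \<Longrightarrow> D < dist x y"
proof -
  let ?I = "{1..K}"
  obtain G where G: "\<forall>k\<in>?I. real_distribution (G k) \<and> compact (msupp (G k)) \<and>
        f k = gauss_conv \<sigma> (G k) \<and> has_bochner_integral lborel (\<lambda>x. x * f k x) 0"
    and w: "\<forall>k\<in>?I. w k > 0" "(\<Sum>k\<in>?I. w k) = 1"
    and sep: "\<forall>j\<in>?I. \<forall>k\<in>?I. j \<noteq> k \<longrightarrow>
        setdist (msupp (translate (G j) (\<mu> j))) (msupp (translate (G k) (\<mu> k)))
          > Max ((\<lambda>l. diameter (msupp (G l))) ` ?I)"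
    and dens: "\<forall>k\<in>?I. prob_density_fun (f k)"
    using assms unfolding mixture_class_def mem_Collect_eq prod.case by blast
  define M where "M k = translate (G k) (\<mu> k)" for k
  \<comment> \<open>One number separates the two scales: distances inside a translated support are
    at most \<open>D\<close>, distances between different ones exceed it. Later arguments use the
    supports only through such a threshold.\<close>
  define D where "D = Max ((\<lambda>l. diameter (msupp (G l))) ` ?I)"
  show thesis
  proof (rule that[of M D])
    show "real_distribution (M k)" if "k \<in> ?I" for k
      using G that by (simp add: M_def real_distribution_translate)
    show "f k (y - \<mu> k) = gauss_conv \<sigma> (M k) y" if "k \<in> ?I" for k y
      using G that by (simp add: M_def gauss_conv_translate)
    show "has_bochner_integral lborel (f k) 1" if "k \<in> ?I" for k
      using dens that by (simp add: prob_density_fun_def)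
    show "has_bochner_integral lborel (\<lambda>x. x * f k x) 0" if "k \<in> ?I" for k
      using G that by blast
    show "0 < w k" if "k \<in> ?I" for k
      using w that by blast
    show "(\<Sum>k\<in>?I. w k) = 1"
      by (fact w(2))
  next
    fix k x y assume k: "k \<in> ?I" and xy: "x \<in> msupp (M k)" "y \<in> msupp (M k)"
    have "dist x y \<le> diameter (msupp (G k))"
      using G k xy unfolding M_def by (intro dist_msupp_translate_le compact_imp_bounded) auto
    also have "\<dots> \<le> D"
      unfolding D_def using k by (intro Max_ge) auto
    finally show "dist x y \<le> D" .
  next
    fix j k x y assume *: "j \<in> ?I" "k \<in> ?I" "j \<noteq> k" and xy: "x \<in> msupp (M j)" "y \<in> msupp (M k)"
    have "D < setdist (msupp (M j)) (msupp (M k))"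
      using sep * unfolding D_def M_def by blast
    also have "\<dots> \<le> dist x y"
      using xy by (rule setdist_le_dist)
    finally show "D < dist x y" .
  qed
qed

text \<open>Points of a block \<open>A k\<close> are within D \<le> E of each other, so they cannot
  lie in two blocks of \<open>B\<close>, which are more than E apart. Thus each \<open>A k\<close>
  sits in a single \<open>B (\<tau> k)\<close>. As the unions agree and every \<open>B j\<close> is
  nonempty, \<tau> is onto, hence injective by finiteness, and the inclusions become
  equalities.\<close>

lemma clusters_match_of_le:
  fixes A B :: "'i \<Rightarrow> 'a::metric_space set"
  assumes I: "finite I"
    and un: "(\<Union>k\<in>I. A k) = (\<Union>k\<in>I. B k)"
    and ne: "\<And>k. k \<in> I \<Longrightarrow> A k \<noteq> {}" "\<And>k. k \<in> I \<Longrightarrow> B k \<noteq> {}"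
    and A_in: "\<And>k x y. k \<in> I \<Longrightarrow> x \<in> A k \<Longrightarrow> y \<in> A k \<Longrightarrow> dist x y \<le> D"
    and B_out: "\<And>j k x y. j \<in> I \<Longrightarrow> k \<in> I \<Longrightarrow> j \<noteq> k \<Longrightarrow> x \<in> B j \<Longrightarrow> y \<in> B k \<Longrightarrow> E < dist x y"
    and "D \<le> E"
  shows "\<exists>\<tau>. bij_betw \<tau> I I \<and> (\<forall>k\<in>I. A k = B (\<tau> k))"
proof -
  have "\<exists>j\<in>I. A k \<subseteq> B j" if k: "k \<in> I" for k
  proof -
    obtain x where x: "x \<in> A k"
      using ne(1)[OF k] by blast
    then obtain j where j: "j \<in> I" "x \<in> B j"
      using k un by blast
    have "y \<in> B j" if y: "y \<in> A k" for y
    proof -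
      obtain i where i: "i \<in> I" "y \<in> B i"
        using k y un by blast
      have "dist x y \<le> E"
        using A_in[OF k x y] \<open>D \<le> E\<close> by simp
      then show ?thesis
        using B_out[OF j(1) i(1) _ j(2) i(2)] i by fastforce
    qed
    then show ?thesis
      using j(1) by blast
  qed
  then obtain \<tau> where \<tau>: "\<And>k. k \<in> I \<Longrightarrow> \<tau> k \<in> I" "\<And>k. k \<in> I \<Longrightarrow> A k \<subseteq> B (\<tau> k)"
    by metis
  have B_disj: "i = j" if "i \<in> I" "j \<in> I" "x \<in> B i" "x \<in> B j" for i j x
  proof (rule ccontr)
    assume "i \<noteq> j"
    from B_out[OF that(1,2) this that(3,4)] have "E < 0" by simp
    \<comment> \<open>A point at distance 0 from itself inside a nonempty block forces D, and so E,
      to be nonnegative.\<close>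
    moreover have "0 \<le> D"
    proof -
      obtain y where "y \<in> A i"
        using ne(1) \<open>i \<in> I\<close> by blast
      then show ?thesis
        using A_in[OF \<open>i \<in> I\<close>, of y y] by simp
    qed
    ultimately show False
      using \<open>D \<le> E\<close> by simp
  qed
  \<comment> \<open>The points of \<open>B j\<close> come only from blocks that \<tau> sends to j.
    This gives surjectivity first and, once \<tau> is injective, the reverse inclusion.\<close>
  have hit: "x \<in> (\<Union>k\<in>{k\<in>I. \<tau> k = j}. A k)" if j: "j \<in> I" and x: "x \<in> B j" for j x
  proof -
    obtain k where k: "k \<in> I" "x \<in> A k"
      using un j x by blast
    moreover have "\<tau> k = j"
      using B_disj[OF \<tau>(1)[OF k(1)] j] \<tau>(2)[OF k(1)] k(2) x by blast
    ultimately show ?thesis by blast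
  qed
  have "j \<in> \<tau> ` I" if j: "j \<in> I" for j
    using ne(2)[OF j] hit[OF j] by blast
  then have surj: "\<tau> ` I = I"
    using \<tau>(1) by blast
  then have inj: "inj_on \<tau> I"
    using I by (simp add: eq_card_imp_inj_on)
  have "A k = B (\<tau> k)" if k: "k \<in> I" for k
    using \<tau>(2)[OF k] hit[OF \<tau>(1)[OF k]] inj_onD[OF inj] k by blast
  with surj inj show ?thesis
    by (auto simp: bij_betw_def)
qed

text \<open>The hypotheses are symmetric in the two families, so the one with the smaller threshold
  can be taken as the finer; if that is \<open>B\<close>, the matching found is inverted.\<close>

lemma clusters_match:
  fixes A B :: "'i \<Rightarrow> 'a::metric_space set"
  assumes I: "finite I"
    and un: "(\<Union>k\<in>I. A k) = (\<Union>k\<in>I. B k)"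
    and ne: "\<And>k. k \<in> I \<Longrightarrow> A k \<noteq> {}" "\<And>k. k \<in> I \<Longrightarrow> B k \<noteq> {}"
    and A_in: "\<And>k x y. k \<in> I \<Longrightarrow> x \<in> A k \<Longrightarrow> y \<in> A k \<Longrightarrow> dist x y \<le> D"
    and A_out: "\<And>j k x y. j \<in> I \<Longrightarrow> k \<in> I \<Longrightarrow> j \<noteq> k \<Longrightarrow> x \<in> A j \<Longrightarrow> y \<in> A k \<Longrightarrow> D < dist x y"
    and B_in: "\<And>k x y. k \<in> I \<Longrightarrow> x \<in> B k \<Longrightarrow> y \<in> B k \<Longrightarrow> dist x y \<le> E"
    and B_out: "\<And>j k x y. j \<in> I \<Longrightarrow> k \<in> I \<Longrightarrow> j \<noteq> k \<Longrightarrow> x \<in> B j \<Longrightarrow> y \<in> B k \<Longrightarrow> E < dist x y"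
  shows "\<exists>\<tau>. bij_betw \<tau> I I \<and> (\<forall>k\<in>I. A k = B (\<tau> k))"
proof (cases "D \<le> E")
  case True
  show ?thesis
    by (rule clusters_match_of_le[of I A B D E]) (fact I un ne A_in B_out True)+
next
  case False
  then have "E \<le> D" by simp
  have "\<exists>\<tau>. bij_betw \<tau> I I \<and> (\<forall>k\<in>I. B k = A (\<tau> k))"
    by (rule clusters_match_of_le[of I B A E D]) (fact I un[symmetric] ne B_in A_out \<open>E \<le> D\<close>)+
  then obtain \<tau> where \<tau>: "bij_betw \<tau> I I" "\<And>k. k \<in> I \<Longrightarrow> B k = A (\<tau> k)"
    by blast
  have "A k = B (inv_into I \<tau> k)" if "k \<in> I" for k
    using \<tau> that by (metis bij_betw_def bij_betw_inv_into_right inv_into_into)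
  with bij_betw_inv_into[OF \<tau>(1)] show ?thesis
    by blast
qed

section \<open>Supports and restrictions of mixtures\<close>

lemma msupp_union_mixture_subset:
  assumes "finite I"
    and M: "\<And>k. k \<in> I \<Longrightarrow> real_distribution (M k)" and N: "\<And>k. k \<in> I \<Longrightarrow> real_distribution (N k)"
    and w: "\<And>k. k \<in> I \<Longrightarrow> 0 < w k"
    and eq: "\<And>A. A \<in> sets borel \<Longrightarrow>
      (\<Sum>k\<in>I. w k * measure (M k) A) = (\<Sum>k\<in>I. v k * measure (N k) A)"
  shows "(\<Union>k\<in>I. msupp (M k)) \<subseteq> (\<Union>k\<in>I. msupp (N k))"
proof
  fix x assume "x \<in> (\<Union>k\<in>I. msupp (M k))"
  then obtain j where j: "j \<in> I" "x \<in> msupp (M j)" by blast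
  show "x \<in> (\<Union>k\<in>I. msupp (N k))"
  proof (rule ccontr)
    \<comment> \<open>\<open>?U\<close> is open and null for every \<open>N k\<close>, so the
      right-hand mixture vanishes on it. A support point of \<open>M j\<close> in \<open>?U\<close>
      would give the left-hand mixture positive mass there, as all weights \<open>w k\<close> are
      positive.\<close>
    let ?U = "- (\<Union>k\<in>I. msupp (N k))"
    assume "x \<notin> (\<Union>k\<in>I. msupp (N k))"
    moreover have U: "open ?U"
      using assms(1) closed_msupp by (auto intro!: open_Compl closed_UN)
    ultimately have "0 < emeasure (M j) ?U"
      using j(2) unfolding msupp_def by blast
    then have "0 < measure (M j) ?U"
      by (simp add: finite_measure.emeasure_eq_measure[OF prob_space.finite_measure]
        real_distribution.axioms(1)[OF M[OF j(1)]])
    then have "0 < (\<Sum>k\<in>I. w k * measure (M k) ?U)"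
      using j(1) w assms(1) by (intro sum_pos2[of I j]) (simp_all add: less_imp_le)
    also have "\<dots> = (\<Sum>k\<in>I. v k * measure (N k) ?U)"
      using U by (intro eq) auto
    also have "\<dots> = 0"
      using N U by (intro sum.neutral ballI) (subst measure_zero_outside_msupp; auto)
    finally show False by simp
  qed
qed

text \<open>Disjointness of the supports kills every other term on the support of component
  \<open>j\<close>, while that component loses no mass by the restriction. A single weighted
  component is thus read off from the mixture.\<close>

lemma measure_mixture_Int_msupp:
  assumes "finite I" "\<And>k. k \<in> I \<Longrightarrow> real_distribution (M k)"
    and disj: "\<And>k. k \<in> I \<Longrightarrow> k \<noteq> j \<Longrightarrow> msupp (M k) \<inter> msupp (M j) = {}"
    and "j \<in> I" "A \<in> sets borel"
  shows "(\<Sum>k\<in>I. w k * measure (M k) (msupp (M j) \<inter> A)) = w j * measure (M j) A"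
proof -
  have A: "msupp (M j) \<inter> A \<in> sets borel"
    using assms(5) closed_msupp[of "M j"] by auto
  have "(\<Sum>k\<in>I. w k * measure (M k) (msupp (M j) \<inter> A))
      = (\<Sum>k\<in>I. if k = j then w j * measure (M j) A else 0)"
  proof (intro sum.cong refl)
    fix k assume k: "k \<in> I"
    show "w k * measure (M k) (msupp (M j) \<inter> A) = (if k = j then w j * measure (M j) A else 0)"
    proof (cases "k = j")
      case True
      then show ?thesis
        using assms by (simp add: measure_Int_msupp)
    next
      case False
      then have "msupp (M k) \<inter> (msupp (M j) \<inter> A) = {}"
        using disj[OF k] by blast
      then show ?thesis
        using False measure_zero_outside_msupp[OF assms(2)[OF k] A] by simp
    qed
  qed
  then show ?thesis
    using assms(1,4) by simp
qed

section \<open>Identifiability of the mixture model\<close>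

theorem proposition3p4:
  fixes K :: nat and \<sigma> :: real
    and f g :: "nat \<Rightarrow> real \<Rightarrow> real"
    and l \<mu> p m :: "nat \<Rightarrow> real"
  assumes "K \<ge> 1" and "\<sigma> > 0"
    and "(f, l, \<mu>) \<in> mixture_class K \<sigma>"
    and "(g, p, m) \<in> mixture_class K \<sigma>"
    and "\<And>y. (\<Sum>k\<in>{1..K}. l k * f k (y - \<mu> k)) = (\<Sum>k\<in>{1..K}. p k * g k (y - m k))"
  shows "\<exists>\<tau>. \<tau> permutes {1..K} \<and>
    (\<forall>k\<in>{1..K}. g k = f (\<tau> k) \<and> p k = l (\<tau> k) \<and> m k = \<mu> (\<tau> k))"
proof -
  let ?I = "{1..K}"
  obtain M D where M: "\<And>k. k \<in> ?I \<Longrightarrow> real_distribution (M k)"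
    and fM: "\<And>k y. k \<in> ?I \<Longrightarrow> f k (y - \<mu> k) = gauss_conv \<sigma> (M k) y"
    and f: "\<And>k. k \<in> ?I \<Longrightarrow> has_bochner_integral lborel (f k) 1"
      "\<And>k. k \<in> ?I \<Longrightarrow> has_bochner_integral lborel (\<lambda>x. x * f k x) 0"
    and l: "\<And>k. k \<in> ?I \<Longrightarrow> 0 < l k" "(\<Sum>k\<in>?I. l k) = 1"
    and M_in: "\<And>k x y. k \<in> ?I \<Longrightarrow> x \<in> msupp (M k) \<Longrightarrow> y \<in> msupp (M k) \<Longrightarrow> dist x y \<le> D"
    and M_out: "\<And>j k x y. j \<in> ?I \<Longrightarrow> k \<in> ?I \<Longrightarrow> j \<noteq> k \<Longrightarrow>
       x \<in> msupp (M j) \<Longrightarrow> y \<in> msupp (M k) \<Longrightarrow> D < dist x y"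
  proof (rule mixture_classE[OF assms(3)], goal_cases)
    case (1 A d)
    show ?case
      by (rule 1(1)[of A d]) (fact 1)+
  qed
  obtain N E where N: "\<And>k. k \<in> ?I \<Longrightarrow> real_distribution (N k)"
    and gN: "\<And>k y. k \<in> ?I \<Longrightarrow> g k (y - m k) = gauss_conv \<sigma> (N k) y"
    and g: "\<And>k. k \<in> ?I \<Longrightarrow> has_bochner_integral lborel (\<lambda>x. x * g k x) 0"
    and p: "\<And>k. k \<in> ?I \<Longrightarrow> 0 < p k" "(\<Sum>k\<in>?I. p k) = 1"
    and N_in: "\<And>k x y. k \<in> ?I \<Longrightarrow> x \<in> msupp (N k) \<Longrightarrow> y \<in> msupp (N k) \<Longrightarrow> dist x y \<le> E"
    and N_out: "\<And>j k x y. j \<in> ?I \<Longrightarrow> k \<in> ?I \<Longrightarrow> j \<noteq> k \<Longrightarrow>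
       x \<in> msupp (N j) \<Longrightarrow> y \<in> msupp (N k) \<Longrightarrow> E < dist x y"
  proof (rule mixture_classE[OF assms(4)], goal_cases)
    case (1 A d)
    show ?case
      by (rule 1(1)[of A d]) (fact 1)+
  qed

  have gauss_eq: "(\<Sum>k\<in>?I. l k * gauss_conv \<sigma> (M k) y) = (\<Sum>k\<in>?I. p k * gauss_conv \<sigma> (N k) y)" for y
  proof -
    have "(\<Sum>k\<in>?I. l k * gauss_conv \<sigma> (M k) y) = (\<Sum>k\<in>?I. l k * f k (y - \<mu> k))"
      by (intro sum.cong refl) (simp only: fM)
    also have "\<dots> = (\<Sum>k\<in>?I. p k * g k (y - m k))"
      by (fact assms(5))
    also have "\<dots> = (\<Sum>k\<in>?I. p k * gauss_conv \<sigma> (N k) y)"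
      by (intro sum.cong refl) (simp only: gN)
    finally show ?thesis .
  qed
  have mix: "(\<Sum>k\<in>?I. l k * measure (M k) A) = (\<Sum>k\<in>?I. p k * measure (N k) A)"
    if "A \<in> sets borel" for A
    by (rule measure_mixture_eq[OF assms(2) _ _ l(2) M _ p(2) N gauss_eq that])
      (auto simp: less_imp_le l(1) p(1))

  have disj_M: "msupp (M k) \<inter> msupp (M j) = {}" if "j \<in> ?I" "k \<in> ?I" "k \<noteq> j" for j k
  proof -
    \<comment> \<open>A common point would have distance 0 to itself both at most \<open>D\<close>
      and greater than \<open>D\<close>.\<close>
    have False if x: "x \<in> msupp (M k)" "x \<in> msupp (M j)" for x
      using M_out[OF \<open>k \<in> ?I\<close> \<open>j \<in> ?I\<close> \<open>k \<noteq> j\<close> x] M_in[OF \<open>k \<in> ?I\<close> x(1) x(1)] by simp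
    then show ?thesis by blast
  qed
  have disj_N: "msupp (N k) \<inter> msupp (N j) = {}" if "j \<in> ?I" "k \<in> ?I" "k \<noteq> j" for j k
  proof -
    have False if x: "x \<in> msupp (N k)" "x \<in> msupp (N j)" for x
      using N_out[OF \<open>k \<in> ?I\<close> \<open>j \<in> ?I\<close> \<open>k \<noteq> j\<close> x] N_in[OF \<open>k \<in> ?I\<close> x(1) x(1)] by simp
    then show ?thesis by blast
  qed

  have "(\<Union>k\<in>?I. msupp (N k)) \<subseteq> (\<Union>k\<in>?I. msupp (M k))"
    by (rule msupp_union_mixture_subset[where w=p and v=l]) (fact finite_atLeastAtMost M N p(1) mix[symmetric])+
  moreover have "(\<Union>k\<in>?I. msupp (M k)) \<subseteq> (\<Union>k\<in>?I. msupp (N k))"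
    by (rule msupp_union_mixture_subset[where w=l and v=p]) (fact finite_atLeastAtMost M N l(1) mix)+
  ultimately have union: "(\<Union>k\<in>?I. msupp (N k)) = (\<Union>k\<in>?I. msupp (M k))"
    by (rule equalityI)
  have ne: "msupp (N k) \<noteq> {}" "msupp (M k) \<noteq> {}" if "k \<in> ?I" for k
    using M N msupp_nonempty that by auto
  have "\<exists>\<tau>. bij_betw \<tau> ?I ?I \<and> (\<forall>k\<in>?I. msupp (N k) = msupp (M (\<tau> k)))"
    \<comment> \<open>The supports of \<open>N\<close> take the role of the first family, so that
      \<tau> leads from the indices of g to those of f, the direction asked for in the
      conclusion.\<close>
    by (rule clusters_match[where D=E and E=D]) (fact finite_atLeastAtMost union ne N_in N_out M_in M_out)+
  then obtain \<tau> where \<tau>: "bij_betw \<tau> ?I ?I"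
    and supp_eq: "\<And>k. k \<in> ?I \<Longrightarrow> msupp (N k) = msupp (M (\<tau> k))"
    by blast

  have main: "g k = f (\<tau> k) \<and> p k = l (\<tau> k) \<and> m k = \<mu> (\<tau> k)" if k: "k \<in> ?I" for k
  proof -
    have \<tau>k: "\<tau> k \<in> ?I"
      using \<tau> k by (auto simp: bij_betw_def)
    \<comment> \<open>Restricting the equality of mixtures to the common support of
      \<open>N k\<close> and \<open>M (\<tau> k)\<close> isolates one component on each
      side.\<close>
    have *: "p k * measure (N k) A = l (\<tau> k) * measure (M (\<tau> k)) A" if A: "A \<in> sets borel" for A
    proof -
      have "p k * measure (N k) A = (\<Sum>i\<in>?I. p i * measure (N i) (msupp (N k) \<inter> A))"
        using N disj_N k A by (intro measure_mixture_Int_msupp[symmetric]) auto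
      also have "\<dots> = (\<Sum>i\<in>?I. l i * measure (M i) (msupp (M (\<tau> k)) \<inter> A))"
        unfolding supp_eq[OF k] using A closed_msupp by (intro mix[symmetric]) auto
      also have "\<dots> = l (\<tau> k) * measure (M (\<tau> k)) A"
        using M disj_M \<tau>k A by (intro measure_mixture_Int_msupp) auto
      finally show ?thesis .
    qed
    interpret Nk: real_distribution "N k" by (rule N[OF k])
    interpret Mk: real_distribution "M (\<tau> k)" by (rule M[OF \<tau>k])
    \<comment> \<open>On the whole line both measures have mass 1, which leaves the weights.
      Cancelling the positive weight then identifies the measures themselves.\<close>
    have pl: "p k = l (\<tau> k)"
      using *[of UNIV] Nk.prob_space Mk.prob_space by simp
    have "N k = M (\<tau> k)"
      using * pl p(1)[OF k]
      by (intro measure_eqI) (auto simp: Nk.emeasure_eq_measure Mk.emeasure_eq_measure)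
    then have "f (\<tau> k) (y - \<mu> (\<tau> k)) = g k (y - m k)" for y
      using fM[OF \<tau>k] gN[OF k] by simp
    from mean_zero_shift_unique[OF f(1)[OF \<tau>k] f(2)[OF \<tau>k] g[OF k] this] pl
    show ?thesis by simp
  qed
  \<comment> \<open>\<open>permutes\<close> demands the identity outside the index set, whereas
    \<tau> is controlled only on it.\<close>
  define \<rho> where "\<rho> k = (if k \<in> ?I then \<tau> k else k)" for k
  have "bij_betw \<rho> ?I ?I = bij_betw \<tau> ?I ?I"
    by (rule bij_betw_cong) (simp add: \<rho>_def)
  with \<tau> have "bij_betw \<rho> ?I ?I"
    by simp
  then have "\<rho> permutes ?I"
    by (rule bij_imp_permutes) (auto simp: \<rho>_def)
  with main show ?thesis
    by (intro exI[of _ \<rho>]) (auto simp: \<rho>_def)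
qed

end
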